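(* Let $b\in(0,\frac12)$ and $a=\frac14$. Then the attractor $\bigcap_{t\ge0}\phi_t(\tilde\Pi)$ of the billiard flow $\phi_t$ on the square table with one-sided mirror $I=\{\frac14\}\times[0,b]$ has positive, but not full, measure in the phase space $\tilde\Pi$.
   Context: The table is the square $\Pi=[0,\frac12]\times[0,\frac12]$ with a vertical wall $I=\{a\}\times[0,b]$, $a=\frac14$. A point particle moves at unit speed along straight lines; at the boundary of the square it is reflected by the usual law (angle of incidence equals angle of reflection). If it arrives at $I$ from the left it passes through unperturbed; if it arrives at $I$ from the right it is reflected by the usual law. The billiard flow $\phi_t$, $t\ge0$ (a semiflow, since it is not invertible), is defined on the phase space $\tilde\Pi=\Pi\times\mathbb S^1$ (position and direction), with the identifications on the boundary given by the reflection rules. Measure means Lebesgue measure on $\Pi\times\mathbb S^1$. *)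

theory Defs
  imports "HOL-Analysis.Analysis"
begin

type_synonym state = "(real \<times> real) \<times> (real \<times> real)"

definition table :: "(real \<times> real) set" where
  "table = {0..1/2} \<times> {0..1/2}"

definition mirror :: "real \<Rightarrow> real \<Rightarrow> (real \<times> real) set" where
  "mirror a b = {a} \<times> {0..b}"

definition phase_space :: "state set" where
  "phase_space = table \<times> sphere 0 1"

text \<open>
  The reflection rule maps an incoming state to the outgoing state with which it is identified and
  leaves all other states fixed. At a corner, or where the mirror meets the bottom side, both
  components of the velocity are treated simultaneously; the tip of the mirror belongs to the mirror.
\<close>

definition reflect :: "real \<Rightarrow> real \<Rightarrow> state \<Rightarrow> state" where
  "reflect a b = (\<lambda>((x, y), (u, w)).
     ((x, y),
      (if x = 0 \<and> u < 0 \<or> x = 1/2 \<and> u > 0 \<or> (x, y) \<in> mirror a b \<and> u < 0 then - u else u,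
       if y = 0 \<and> w < 0 \<or> y = 1/2 \<and> w > 0 then - w else w)))"

definition free_flight :: "real \<Rightarrow> state \<Rightarrow> state" where
  "free_flight s = (\<lambda>(p, v). (p + s *\<^sub>R v, v))"

definition hit_time :: "real \<Rightarrow> real \<Rightarrow> state \<Rightarrow> real" where
  "hit_time a b z = Inf {s. 0 < s \<and> reflect a b (free_flight s z) \<noteq> free_flight s z}"

definition bounce :: "real \<Rightarrow> real \<Rightarrow> state \<Rightarrow> state" where
  "bounce a b z = reflect a b (free_flight (hit_time a b z) z)"

definition bounce_time :: "real \<Rightarrow> real \<Rightarrow> nat \<Rightarrow> state \<Rightarrow> real" where
  "bounce_time a b n z = (\<Sum>k<n. hit_time a b ((bounce a b ^^ k) z))"

text \<open>
  The boundary identifications are realised by replacing the initial state by its outgoing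
  representative, so that identified states have the same orbit, and every state on an orbit is
  outgoing. At time \<open>t\<close> the particle has bounced \<open>n\<close> times, where
  \<open>bounce_time a b n z\<^sub>0 \<le> t < bounce_time a b (Suc n) z\<^sub>0\<close>.
\<close>

definition flow :: "real \<Rightarrow> real \<Rightarrow> real \<Rightarrow> state \<Rightarrow> state" where
  "flow a b t z =
     (let z\<^sub>0 = reflect a b z;
          n = (LEAST n. t < bounce_time a b (Suc n) z\<^sub>0)
      in free_flight (t - bounce_time a b n z\<^sub>0) ((bounce a b ^^ n) z\<^sub>0))"

definition attractor :: "real \<Rightarrow> real \<Rightarrow> state set" where
  "attractor a b = (\<Inter>t\<in>{0..}. flow a b t ` phase_space)"

definition arc_length :: "(real \<times> real) measure" where
  "arc_length =
     distr (restrict_space lborel {0..<2 * pi}) (restrict_space borel (sphere 0 1))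
       (\<lambda>\<theta>. (cos \<theta>, sin \<theta>))"

definition phase_measure :: "state measure" where
  "phase_measure = completion (restrict_space lborel table \<Otimes>\<^sub>M arc_length)"

end

theory Submission
  imports Defs
begin

text \<open>
  Folding the table along \<open>x = 1/4\<close> semiconjugates the flow to the billiard in the half table, which
  is an invertible flow: at a crossing of the wall the fold does not see whether the particle is
  reflected. Hence every image \<open>\<phi>\<^sub>t(\<Pi>)\<close> meets every fibre \<open>{z, \<sigma> z}\<close> of the fold, where \<open>\<sigma>\<close> is the
  reflection in \<open>x = 1/4\<close>. The images decrease with \<open>t\<close>, so the attractor meets every fibre too, and
  it cannot be null because \<open>\<sigma>\<close> preserves null sets. It is Borel since \<open>\<phi>\<^sub>t\<close> is Borel and agrees
  pointwise with one of countably many invertible maps. It is not of full measure, since states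
  just to the left of the mirror that move left have no past.
\<close>

section \<open>Free flight up to the first collision\<close>

definition outgoing :: "real \<Rightarrow> real \<Rightarrow> state set" where
  "outgoing a b = {z \<in> phase_space. reflect a b z = z}"

definition collision_times :: "real \<Rightarrow> real \<Rightarrow> state \<Rightarrow> real set" where
  "collision_times a b z = {s. 0 < s \<and> reflect a b (free_flight s z) \<noteq> free_flight s z}"

lemma free_flight_simp [simp]:
  "free_flight s ((x, y), (u, w)) = ((x + s * u, y + s * w), (u, w))"
  by (simp add: free_flight_def)

lemma free_flight_0 [simp]: "free_flight 0 z = z"
  by (cases z) (simp add: free_flight_def)

lemma free_flight_free_flight [simp]: "free_flight s (free_flight t z) = free_flight (s + t) z"
  by (cases z) (simp add: free_flight_def algebra_simps)

lemma in_phase_space_iff: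
  "((x, y), (u, w)) \<in> phase_space \<longleftrightarrow>
     0 \<le> x \<and> x \<le> 1/2 \<and> 0 \<le> y \<and> y \<le> 1/2 \<and> u\<^sup>2 + w\<^sup>2 = 1"
  by (auto simp: phase_space_def table_def norm_Pair)

lemma reflect_fixed_iff:
  "reflect a b ((x, y), (u, w)) = ((x, y), (u, w)) \<longleftrightarrow>
     \<not> (x = 0 \<and> u < 0 \<or> x = 1/2 \<and> u > 0 \<or> x = a \<and> 0 \<le> y \<and> y \<le> b \<and> u < 0) \<and>
     \<not> (y = 0 \<and> w < 0 \<or> y = 1/2 \<and> w > 0)"
  by (auto simp: reflect_def mirror_def)

lemma hit_time_eq: "hit_time a b z = Inf (collision_times a b z)"
  by (simp add: hit_time_def collision_times_def)

text \<open>Candidates are functions of the state, not numbers, so that one finite set gives both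
  finiteness of \<open>collision_times\<close> and measurability of \<open>hit_time\<close>. Where a
  velocity component vanishes the quotient is the junk value 0, harmless because only an inclusion
  is claimed.\<close>

definition wall_times :: "real \<Rightarrow> (state \<Rightarrow> real) set" where
  "wall_times a =
     {\<lambda>z. - fst (fst z) / fst (snd z), \<lambda>z. (1/2 - fst (fst z)) / fst (snd z),
      \<lambda>z. (a - fst (fst z)) / fst (snd z),
      \<lambda>z. - snd (fst z) / snd (snd z), \<lambda>z. (1/2 - snd (fst z)) / snd (snd z)}"

lemma collision_times_subset: "collision_times a b z \<subseteq> (\<lambda>f. f z) ` wall_times a"
proof
  fix s assume s: "s \<in> collision_times a b z"
  obtain x y u w where z: "z = ((x, y), (u, w))" by (metis surj_pair)
  have "x + s * u = 0 \<and> u \<noteq> 0 \<or> x + s * u = 1/2 \<and> u \<noteq> 0 \<or> x + s * u = a \<and> u \<noteq> 0 \<or>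
        y + s * w = 0 \<and> w \<noteq> 0 \<or> y + s * w = 1/2 \<and> w \<noteq> 0"
    using s unfolding collision_times_def z by (auto simp: reflect_fixed_iff)
  then show "s \<in> (\<lambda>f. f z) ` wall_times a"
    unfolding wall_times_def z by (auto simp: field_simps)
qed

lemma finite_collision_times: "finite (collision_times a b z)"
  by (rule finite_subset[OF collision_times_subset]) (simp add: wall_times_def)

lemma hit_time_le: "s \<in> collision_times a b z \<Longrightarrow> hit_time a b z \<le> s"
  unfolding hit_time_eq by (intro cInf_lower bdd_below_finite finite_collision_times)

lemma reflect_in_outgoing:
  assumes "0 < a" "a < 1/2" "z \<in> phase_space"
  shows "reflect a b z \<in> outgoing a b"
  using assms
  by (cases z) (auto simp: outgoing_def reflect_def mirror_def in_phase_space_iff)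

text \<open>At unit speed some velocity component is nonzero, and the line of the outer side it
  points to is reached after a positive time, since an outgoing state on that side points away from
  it. Another wall may be hit earlier.\<close>

lemma collision_times_nonempty:
  assumes "z \<in> outgoing a b"
  shows "collision_times a b z \<noteq> {}"
proof -
  obtain x y u w where z: "z = ((x, y), (u, w))" by (metis surj_pair)
  have ps: "0 \<le> x" "x \<le> 1/2" "0 \<le> y" "y \<le> 1/2" "u\<^sup>2 + w\<^sup>2 = 1"
    and fx: "\<not> (x = 0 \<and> u < 0)" "\<not> (x = 1/2 \<and> u > 0)" "\<not> (y = 0 \<and> w < 0)" "\<not> (y = 1/2 \<and> w > 0)"
    using assms unfolding outgoing_def z by (auto simp: in_phase_space_iff reflect_fixed_iff)
  have "u < 0 \<or> u > 0 \<or> w < 0 \<or> w > 0"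
    using ps(5) by (cases "u = 0"; cases "w = 0") auto
  then have "\<exists>s>0. x + s * u = 0 \<and> u < 0 \<or> x + s * u = 1/2 \<and> u > 0 \<or>
               y + s * w = 0 \<and> w < 0 \<or> y + s * w = 1/2 \<and> w > 0"
  proof (elim disjE)
    assume "u < 0" then show ?thesis using ps fx by (intro exI[of _ "- x / u"]) (auto simp: divide_simps)
  next
    assume "u > 0" then show ?thesis using ps fx by (intro exI[of _ "(1/2 - x) / u"]) (auto simp: divide_simps)
  next
    assume "w < 0" then show ?thesis using ps fx by (intro exI[of _ "- y / w"]) (auto simp: divide_simps)
  next
    assume "w > 0" then show ?thesis using ps fx by (intro exI[of _ "(1/2 - y) / w"]) (auto simp: divide_simps)
  qed
  then obtain s where "s > 0" and s: "x + s * u = 0 \<and> u < 0 \<or> x + s * u = 1/2 \<and> u > 0 \<or>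
               y + s * w = 0 \<and> w < 0 \<or> y + s * w = 1/2 \<and> w > 0" by blast
  moreover have "reflect a b (free_flight s z) \<noteq> free_flight s z"
    unfolding z free_flight_simp reflect_fixed_iff using s by blast
  ultimately show ?thesis
    unfolding collision_times_def by blast
qed

lemma hit_time_in_collision_times:
  assumes "z \<in> outgoing a b"
  shows "hit_time a b z \<in> collision_times a b z"
  unfolding hit_time_eq
  using finite_collision_times collision_times_nonempty[OF assms]
  by (simp add: cInf_eq_Min)

lemma hit_time_pos: "z \<in> outgoing a b \<Longrightarrow> 0 < hit_time a b z"
  using hit_time_in_collision_times by (auto simp: collision_times_def)

lemma reflect_free_flight_before_hit:
  assumes "z \<in> outgoing a b" "0 \<le> s" "s < hit_time a b z"
  shows "reflect a b (free_flight s z) = free_flight s z"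
proof (cases "s = 0")
  case True
  then show ?thesis using assms by (simp add: outgoing_def)
next
  case False
  then have "s \<notin> collision_times a b z"
    using hit_time_le[of s a b z] assms(3) by auto
  then show ?thesis using False assms(2) by (auto simp: collision_times_def)
qed

text \<open>An affine function that exceeds \<open>c\<close> at time \<open>h\<close> crosses it
  increasingly at the earlier time \<open>(c - x) / u\<close>. With signs changed this serves all
  four sides of the table.\<close>

lemma affine_stays_below:
  fixes x u :: real
  assumes "x \<le> c" "0 \<le> h" "\<And>s. 0 \<le> s \<Longrightarrow> s < h \<Longrightarrow> x + s * u = c \<Longrightarrow> u \<le> 0"
  shows "x + h * u \<le> c"
proof (rule ccontr)
  assume "\<not> x + h * u \<le> c"
  then have *: "c < x + h * u" by simp
  then have "0 < h * u" using assms(1) by linarith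
  then have u: "0 < u" using assms(2) by (simp add: zero_less_mult_iff)
  have "(c - x) / u < h" "0 \<le> (c - x) / u" using u * assms(1) by (simp_all add: field_simps)
  then show False using assms(3)[of "(c - x) / u"] u by simp
qed

text \<open>Leaving the table means crossing a side outward before time \<open>s\<close>, where
  \<open>reflect\<close> would act. As \<open>reflect\<close> tests each side as a full line, the
  four inequalities can be proved independently.\<close>

lemma free_flight_in_phase_space:
  assumes z: "z \<in> outgoing a b" and s: "0 \<le> s" "s \<le> hit_time a b z"
  shows "free_flight s z \<in> phase_space"
proof -
  obtain x y u w where zz: "z = ((x, y), (u, w))" by (metis surj_pair)
  have ps: "0 \<le> x" "x \<le> 1/2" "0 \<le> y" "y \<le> 1/2" "u\<^sup>2 + w\<^sup>2 = 1"
    using z unfolding outgoing_def zz by (auto simp: in_phase_space_iff)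
  have fixed: "reflect a b ((x + r * u, y + r * w), (u, w)) = ((x + r * u, y + r * w), (u, w))"
    if "0 \<le> r" "r < s" for r
    using reflect_free_flight_before_hit[OF z, of r] that s by (simp add: zz)
  have "x + s * u \<le> 1/2"
    by (rule affine_stays_below) (use ps s fixed in \<open>force simp: reflect_fixed_iff not_less\<close>)+
  moreover have "y + s * w \<le> 1/2"
    by (rule affine_stays_below) (use ps s fixed in \<open>force simp: reflect_fixed_iff not_less\<close>)+
  moreover have "- x + s * (- u) \<le> 0"
    by (rule affine_stays_below) (use ps s fixed in \<open>force simp: reflect_fixed_iff not_less\<close>)+
  moreover have "- y + s * (- w) \<le> 0"
    by (rule affine_stays_below) (use ps s fixed in \<open>force simp: reflect_fixed_iff not_less\<close>)+
  ultimately show ?thesis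
    using ps by (simp add: zz in_phase_space_iff)
qed

lemma free_flight_in_outgoing:
  assumes "z \<in> outgoing a b" "0 \<le> s" "s < hit_time a b z"
  shows "free_flight s z \<in> outgoing a b"
  using free_flight_in_phase_space[OF assms(1,2)] reflect_free_flight_before_hit[OF assms] assms(3)
  by (simp add: outgoing_def)

lemma hit_time_free_flight:
  assumes "z \<in> outgoing a b" "0 \<le> s" "s < hit_time a b z"
  shows "hit_time a b (free_flight s z) = hit_time a b z - s"
proof (rule antisym)
  show "hit_time a b (free_flight s z) \<le> hit_time a b z - s"
    using hit_time_in_collision_times[OF assms(1)] assms(3)
    by (intro hit_time_le) (auto simp: collision_times_def)
  have "hit_time a b (free_flight s z) + s \<in> collision_times a b z"
    using hit_time_in_collision_times[OF free_flight_in_outgoing[OF assms]] assms(2)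
    by (auto simp: collision_times_def)
  from hit_time_le[OF this] show "hit_time a b z - s \<le> hit_time a b (free_flight s z)" by simp
qed

lemma bounce_free_flight:
  assumes "z \<in> outgoing a b" "0 \<le> s" "s < hit_time a b z"
  shows "bounce a b (free_flight s z) = bounce a b z"
  using hit_time_free_flight[OF assms] by (simp add: bounce_def)

section \<open>Bounces do not accumulate\<close>

text \<open>Lower bounds for the distances to the next vertical and the next horizontal wall. They shrink
  at most at unit speed, and each bounce resets one of them from zero to at least
  \<open>1/2 - a\<close>; this excludes infinitely many bounces in finite time.\<close>

definition x_room :: "real \<Rightarrow> real \<Rightarrow> real \<Rightarrow> real" where
  "x_room a x u = (if u > 0 then 1/2 - x else if u < 0 then (if x \<ge> a then x - a else x) else 0)"

definition y_room :: "real \<Rightarrow> real \<Rightarrow> real" where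
  "y_room y w = (if w > 0 then 1/2 - y else if w < 0 then y else 0)"

definition room :: "real \<Rightarrow> state \<Rightarrow> real" where
  "room a = (\<lambda>((x, y), (u, w)). x_room a x u + y_room y w)"

text \<open>A flipped component had room zero. The smallest reset is \<open>1/2 - a\<close>, the
  width of the strip between the mirror and the right side; at a corner both rooms are
  reset.\<close>

lemma room_reflect:
  assumes a: "0 < a" "a < 1/2" and "reflect a b z \<noteq> z"
  shows "room a z + (1/2 - a) \<le> room a (reflect a b z)"
proof -
  obtain x y u w where z: "z = ((x, y), (u, w))" by (metis surj_pair)
  obtain u' w' where r: "reflect a b z = ((x, y), (u', w'))" by (simp add: z reflect_def)
  have "u' = u \<or> x_room a x u + (1/2 - a) \<le> x_room a x u'"
    using r a by (auto simp: z reflect_def mirror_def x_room_def split: if_splits)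
  moreover have "w' = w \<or> y_room y w + (1/2 - a) \<le> y_room y w'"
    using r a by (auto simp: z reflect_def y_room_def split: if_splits)
  moreover have "u' \<noteq> u \<or> w' \<noteq> w"
    using assms(3) r z by auto
  ultimately show ?thesis
    using a unfolding r unfolding z room_def by auto
qed

text \<open>The factor 2 counts the two rooms. Passing \<open>x = a\<close> leftwards makes
  \<open>x_room\<close> jump up by \<open>a\<close>, which only helps.\<close>

lemma room_free_flight:
  assumes "0 < a" "z \<in> phase_space" "0 \<le> s"
  shows "room a z - 2 * s \<le> room a (free_flight s z)"
proof -
  obtain x y u w where z: "z = ((x, y), (u, w))" by (metis surj_pair)
  have uw: "u\<^sup>2 + w\<^sup>2 = 1" using assms(2) unfolding z by (simp add: in_phase_space_iff)
  have "u\<^sup>2 \<le> 1" "w\<^sup>2 \<le> 1" using uw zero_le_power2[of u] zero_le_power2[of w] by linarith+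
  then have "\<bar>u\<bar> \<le> 1" "\<bar>w\<bar> \<le> 1" by (simp_all add: abs_square_le_1)
  then have "\<bar>s * u\<bar> \<le> s" "\<bar>s * w\<bar> \<le> s"
    using assms(3) by (simp_all add: abs_mult mult_left_le)
  moreover have "0 < u \<Longrightarrow> 0 \<le> s * u" "u < 0 \<Longrightarrow> s * u \<le> 0"
    using assms(3) by (simp_all add: mult_le_0_iff)
  ultimately have "x_room a x u - s \<le> x_room a (x + s * u) u" "y_room y w - s \<le> y_room (y + s * w) w"
    using assms(1,3) by (auto simp: x_room_def y_room_def)
  then show ?thesis by (simp add: z room_def)
qed

lemma room_bounds:
  assumes "0 < a" "z \<in> phase_space"
  shows "0 \<le> room a z" "room a z \<le> 1"
proof -
  obtain x y u w where z: "z = ((x, y), (u, w))" by (metis surj_pair)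
  have "0 \<le> x_room a x u" "x_room a x u \<le> 1/2" "0 \<le> y_room y w" "y_room y w \<le> 1/2"
    using assms unfolding z by (auto simp: x_room_def y_room_def in_phase_space_iff)
  then show "0 \<le> room a z" "room a z \<le> 1" by (simp_all add: z room_def)
qed

section \<open>Semigroup law and decreasing images\<close>

context
  fixes a b :: real
  assumes a: "0 < a" "a < 1/2"
begin

lemma bounce_in_outgoing: "z \<in> outgoing a b \<Longrightarrow> bounce a b z \<in> outgoing a b"
  unfolding bounce_def
  by (intro reflect_in_outgoing a free_flight_in_phase_space) (auto intro: less_imp_le hit_time_pos)

lemma funpow_bounce_in_outgoing: "z \<in> outgoing a b \<Longrightarrow> (bounce a b ^^ n) z \<in> outgoing a b"
  by (induction n) (auto intro: bounce_in_outgoing)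

lemma room_bounce:
  assumes "z \<in> outgoing a b"
  shows "room a z + (1/2 - a) - 2 * hit_time a b z \<le> room a (bounce a b z)"
proof -
  let ?z = "free_flight (hit_time a b z) z"
  have "room a z - 2 * hit_time a b z \<le> room a ?z"
    using assms a hit_time_pos[OF assms] by (intro room_free_flight) (auto simp: outgoing_def)
  also have "room a ?z + (1/2 - a) \<le> room a (bounce a b z)"
    unfolding bounce_def using hit_time_in_collision_times[OF assms]
    by (intro room_reflect a) (simp add: collision_times_def)
  finally show ?thesis by simp
qed

text \<open>Each bounce adds at least \<open>1/2 - a\<close> to the room and each unit of time
  removes at most 2, while the room stays between 0 and 1.\<close>

lemma bounce_time_ge:
  assumes "z \<in> outgoing a b"
  shows "real n * (1/2 - a) - 1 \<le> 2 * bounce_time a b n z"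
proof -
  define c where "c = 1/2 - a"
  have "room a z + real n * c - 2 * bounce_time a b n z \<le> room a ((bounce a b ^^ n) z)"
  proof (induction n)
    case (Suc n)
    have "real (Suc n) * c = real n * c + c" by (simp add: algebra_simps)
    moreover have "bounce_time a b (Suc n) z = bounce_time a b n z + hit_time a b ((bounce a b ^^ n) z)"
      by (simp add: bounce_time_def)
    moreover have "(bounce a b ^^ Suc n) z = bounce a b ((bounce a b ^^ n) z)" by simp
    ultimately show ?case
      using Suc room_bounce[OF funpow_bounce_in_outgoing[OF assms, of n], folded c_def]
      by simp
  qed (simp add: bounce_time_def)
  moreover have "0 \<le> room a z"
    using assms by (intro room_bounds a) (simp add: outgoing_def)
  moreover have "room a ((bounce a b ^^ n) z) \<le> 1"
    using funpow_bounce_in_outgoing[OF assms, of n] by (intro room_bounds a) (simp add: outgoing_def)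
  ultimately show ?thesis by (simp flip: c_def)
qed

lemma bounce_time_Suc_gt:
  "z \<in> outgoing a b \<Longrightarrow> bounce_time a b n z < bounce_time a b (Suc n) z"
  using hit_time_pos[OF funpow_bounce_in_outgoing] by (simp add: bounce_time_def)

lemma bounce_time_mono:
  assumes "z \<in> outgoing a b" "m \<le> n"
  shows "bounce_time a b m z \<le> bounce_time a b n z"
  using lift_Suc_mono_le[of "\<lambda>n. bounce_time a b n z", OF _ assms(2)] bounce_time_Suc_gt[OF assms(1)]
  by (auto intro: less_imp_le)

text \<open>Bounce times are unbounded, so the \<open>LEAST\<close> in \<open>flow\<close> is
  attained and the flow is defined for all \<open>t \<ge> 0\<close>.\<close>

lemma bounce_number_exists:
  assumes "z \<in> outgoing a b" "0 \<le> t"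
  obtains n where "bounce_time a b n z \<le> t" "t < bounce_time a b (Suc n) z"
proof -
  obtain N where "(2 * t + 1) / (1/2 - a) < real N" using reals_Archimedean2 by blast
  then have "2 * t + 1 < real N * (1/2 - a)" using a by (simp add: field_simps)
  then have "2 * t + 1 < real (Suc N) * (1/2 - a)" using a by (simp add: algebra_simps)
  then have ex: "t < bounce_time a b (Suc N) z" using bounce_time_ge[OF assms(1), of "Suc N"] by simp
  define n where "n = (LEAST n. t < bounce_time a b (Suc n) z)"
  have "t < bounce_time a b (Suc n) z" unfolding n_def using ex by (rule LeastI)
  moreover have "bounce_time a b n z \<le> t"
  proof (cases n)
    case 0
    then show ?thesis using assms(2) by (simp add: bounce_time_def)
  next
    case (Suc k)
    then show ?thesis using not_less_Least[of k "\<lambda>n. t < bounce_time a b (Suc n) z"] by (simp add: n_def)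
  qed
  ultimately show thesis using that by blast
qed

lemma flow_eq:
  assumes z: "reflect a b z \<in> outgoing a b"
    and n: "bounce_time a b n (reflect a b z) \<le> t" "t < bounce_time a b (Suc n) (reflect a b z)"
  shows "flow a b t z =
    free_flight (t - bounce_time a b n (reflect a b z)) ((bounce a b ^^ n) (reflect a b z))"
proof -
  have "(LEAST n. t < bounce_time a b (Suc n) (reflect a b z)) = n"
  proof (rule Least_equality)
    fix m assume m: "t < bounce_time a b (Suc m) (reflect a b z)"
    show "n \<le> m"
      using bounce_time_mono[OF z, of "Suc m" n] m n(1) by (cases "n \<le> m") auto
  qed (use n in simp)
  then show ?thesis by (simp add: flow_def Let_def)
qed

lemma flow_cases:
  assumes "z \<in> phase_space" "0 \<le> t"
  obtains n r where
    "r = t - bounce_time a b n (reflect a b z)"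
    "0 \<le> r" "r < hit_time a b ((bounce a b ^^ n) (reflect a b z))"
    "(bounce a b ^^ n) (reflect a b z) \<in> outgoing a b"
    "flow a b t z = free_flight r ((bounce a b ^^ n) (reflect a b z))"
proof -
  have z: "reflect a b z \<in> outgoing a b" by (intro reflect_in_outgoing a assms)
  obtain n where n: "bounce_time a b n (reflect a b z) \<le> t"
    "t < bounce_time a b (Suc n) (reflect a b z)"
    using bounce_number_exists[OF z assms(2)] .
  show thesis
    by (rule that[OF refl]) (use n flow_eq[OF z n] funpow_bounce_in_outgoing[OF z] in
        \<open>auto simp: bounce_time_def\<close>)
qed

lemma flow_in_outgoing:
  assumes "z \<in> phase_space" "0 \<le> t"
  shows "flow a b t z \<in> outgoing a b"
  using flow_cases[OF assms] free_flight_in_outgoing by metis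

text \<open>Restarting at time \<open>s\<close>, after \<open>n\<close> bounces, shifts the bounce
  index by \<open>n\<close> and the bounce times by \<open>s\<close>.\<close>

lemma flow_add:
  assumes z: "z \<in> phase_space" and st: "0 \<le> s" "0 \<le> t"
  shows "flow a b (s + t) z = flow a b t (flow a b s z)"
proof -
  define z0 where "z0 = reflect a b z"
  obtain n r where r: "r = s - bounce_time a b n z0" "0 \<le> r" "r < hit_time a b ((bounce a b ^^ n) z0)"
    "(bounce a b ^^ n) z0 \<in> outgoing a b" and fl: "flow a b s z = free_flight r ((bounce a b ^^ n) z0)"
    using flow_cases[OF z st(1)] unfolding z0_def by metis
  define z1 where "z1 = flow a b s z"
  have z0: "z0 \<in> outgoing a b" unfolding z0_def by (intro reflect_in_outgoing a z)
  have z1: "z1 \<in> outgoing a b" unfolding z1_def by (intro flow_in_outgoing z st)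
  then have refl1: "reflect a b z1 = z1" by (simp add: outgoing_def)
  \<comment> \<open>Only positive indices shift exactly: at index 0 the restarted state
    \<open>z1\<close> lies in mid-flight, \<open>r\<close> after the \<open>n\<close>-th bounce.
    Hence the separate case \<open>k = 0\<close> further on.\<close>
  have pow: "(bounce a b ^^ Suc k) z1 = (bounce a b ^^ (n + Suc k)) z0" for k
  proof (induction k)
    case 0
    then show ?case using bounce_free_flight[OF r(4,2,3)] by (simp add: z1_def fl)
  qed simp
  have bt: "bounce_time a b (Suc k) z1 = bounce_time a b (n + Suc k) z0 - s" for k
  proof (induction k)
    case 0
    then show ?case using hit_time_free_flight[OF r(4,2,3)] r(1)
      by (simp add: z1_def fl bounce_time_def)
  next
    case (Suc k)
    have "bounce_time a b (Suc (Suc k)) z1 = bounce_time a b (Suc k) z1 + hit_time a b ((bounce a b ^^ Suc k) z1)"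
      by (simp add: bounce_time_def)
    also have "\<dots> = bounce_time a b (n + Suc (Suc k)) z0 - s"
      unfolding Suc pow by (simp add: bounce_time_def)
    finally show ?case .
  qed
  obtain k where k: "bounce_time a b k z1 \<le> t" "t < bounce_time a b (Suc k) z1"
    using bounce_number_exists[OF z1 st(2)] .
  have lo: "bounce_time a b (n + k) z0 \<le> s + t"
    using k(1) bt r st by (cases k) auto
  have hi: "s + t < bounce_time a b (Suc (n + k)) z0"
    using k(2) bt[of k] by simp
  have "flow a b (s + t) z = free_flight (s + t - bounce_time a b (n + k) z0) ((bounce a b ^^ (n + k)) z0)"
    using flow_eq[of z "n + k" "s + t"] lo hi z0 by (simp add: z0_def)
  also have "\<dots> = free_flight (t - bounce_time a b k z1) ((bounce a b ^^ k) z1)"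
  proof (cases k)
    case 0
    then show ?thesis by (simp add: z1_def fl r(1) bounce_time_def algebra_simps)
  next
    case (Suc j)
    show ?thesis unfolding Suc bt pow by (simp add: algebra_simps)
  qed
  also have "\<dots> = flow a b t z1"
    using flow_eq[of z1 k t] k z1 by (simp add: refl1)
  finally show ?thesis by (simp add: z1_def)
qed

lemma flow_image_antimono:
  assumes "0 \<le> s" "s \<le> t"
  shows "flow a b t ` phase_space \<subseteq> flow a b s ` phase_space"
proof
  fix z assume "z \<in> flow a b t ` phase_space"
  then obtain z' where z': "z' \<in> phase_space" "z = flow a b t z'" by auto
  have "z = flow a b s (flow a b (t - s) z')"
    using flow_add[of z' "t - s" s] z' assms by simp
  moreover have "flow a b (t - s) z' \<in> phase_space"
    using flow_in_outgoing[of z' "t - s"] z' assms by (simp add: outgoing_def)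
  ultimately show "z \<in> flow a b s ` phase_space" by blast
qed

text \<open>Decreasing images allow a countable intersection, which Borel measurability
  requires.\<close>

lemma attractor_eq_INT_nat: "attractor a b = (\<Inter>n. flow a b (real n) ` phase_space)"
proof
  show "(\<Inter>n. flow a b (real n) ` phase_space) \<subseteq> attractor a b"
    unfolding attractor_def
  proof (intro INT_greatest)
    fix t :: real assume "t \<in> {0..}"
    moreover obtain n where "t \<le> real n" using real_arch_simple by blast
    ultimately show "(\<Inter>n. flow a b (real n) ` phase_space) \<subseteq> flow a b t ` phase_space"
      using flow_image_antimono[of t "real n"] by blast
  qed
qed (auto simp: attractor_def)

lemma attractor_subset: "attractor a b \<subseteq> phase_space"
  using flow_in_outgoing[of _ 0] by (auto simp: attractor_def outgoing_def)

end

section \<open>Borel measurability of the flow\<close>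

text \<open>Sublevel sets of the infimum are finite unions over \<open>F\<close>. Where
  \<open>S z\<close> is empty the value is the constant \<open>Inf {}\<close>, which gets its own
  branch.\<close>

lemma borel_measurable_Inf_selection:
  fixes S :: "'a \<Rightarrow> real set"
  assumes F: "finite F" "\<And>z. S z \<subseteq> (\<lambda>f. f z) ` F"
    and f [measurable]: "\<And>f. f \<in> F \<Longrightarrow> f \<in> borel_measurable M"
    and S [measurable]: "\<And>f. f \<in> F \<Longrightarrow> Measurable.pred M (\<lambda>z. f z \<in> S z)"
  shows "(\<lambda>z. Inf (S z)) \<in> borel_measurable M"
proof (rule borel_measurableI_less)
  fix r :: real
  have "Inf (S z) < r \<longleftrightarrow>
      (if \<exists>f\<in>F. f z \<in> S z then \<exists>f\<in>F. f z \<in> S z \<and> f z < r else Inf {} < r)" for z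
  proof (cases "S z = {}")
    case False
    have "bdd_below (S z)"
      using finite_subset[OF F(2)] F(1) by (intro bdd_below_finite) simp
    then show ?thesis
      using False F(2)[of z] by (auto simp: cInf_less_iff)
  qed simp
  then show "{z \<in> space M. Inf (S z) < r} \<in> sets M"
    using F(1) by simp
qed

lemma borel_measurable_fst' [measurable]:
  "fst \<in> borel_measurable (borel :: ('a::topological_space \<times> 'b::topological_space) measure)"
  and borel_measurable_snd' [measurable]:
  "snd \<in> borel_measurable (borel :: ('a \<times> 'b) measure)"
  by (intro borel_measurable_continuous_onI continuous_intros)+

lemma borel_measurable_free_flight [measurable (raw)]:
  assumes [measurable]: "f \<in> borel_measurable M" "g \<in> borel_measurable M"
  shows "(\<lambda>x. free_flight (f x) (g x)) \<in> borel_measurable M"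
  unfolding free_flight_def split_beta by measurable

lemma borel_measurable_reflect [measurable]: "reflect a b \<in> borel_measurable borel"
  unfolding reflect_def split_beta mirror_def mem_Times_iff by simp

lemma borel_measurable_hit_time [measurable]: "hit_time a b \<in> borel_measurable borel"
proof -
  have [measurable]: "f \<in> borel_measurable borel" if "f \<in> wall_times a" for f
    using that unfolding wall_times_def by auto
  have "(\<lambda>z. Inf (collision_times a b z)) \<in> borel_measurable borel"
    by (rule borel_measurable_Inf_selection[OF _ collision_times_subset])
       (auto simp: collision_times_def wall_times_def)
  then show ?thesis by (simp add: hit_time_eq[abs_def])
qed

lemma borel_measurable_bounce [measurable]: "bounce a b \<in> borel_measurable borel"
  unfolding bounce_def[abs_def] by measurable

lemma borel_measurable_funpow_bounce [measurable]: "bounce a b ^^ n \<in> borel_measurable borel"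
  by (induction n) (auto simp: id_def intro: measurable_comp)

lemma borel_measurable_bounce_time [measurable]: "bounce_time a b n \<in> borel_measurable borel"
  unfolding bounce_time_def[abs_def] by measurable

text \<open>For each fixed bounce number the formula is Borel, and the bounce number is a Borel
  function into a countable set.\<close>

lemma borel_measurable_flow [measurable]: "flow a b t \<in> borel_measurable borel"
  unfolding flow_def[abs_def] Let_def
  by (rule measurable_compose_countable[where
      f = "\<lambda>n z. free_flight (t - bounce_time a b n (reflect a b z)) ((bounce a b ^^ n) (reflect a b z))"])
     measurable

lemma phase_space_borel [measurable]: "phase_space \<in> sets borel"
  unfolding phase_space_def table_def by (intro borel_closed closed_Times) auto

section \<open>Unfolding orbits to straight lines\<close>

text \<open>Because \<open>a = 1/4\<close> is the midpoint, the reflections in \<open>x = 0\<close>, \<open>x = 1/4\<close>, \<open>x = 1/2\<close> and in the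
  horizontal sides all belong to the group of isometries below, so an orbit is sent to a straight
  line by a choice of group element along it, whether or not the mirror acts at a crossing.\<close>

definition unfold :: "bool \<times> int \<times> bool \<times> int \<Rightarrow> state \<Rightarrow> state" where
  "unfold = (\<lambda>(e, m, d, n) ((x, y), (u, w)).
     (((if e then x else - x) + m / 2, (if d then y else - y) + n),
      (if e then u else - u, if d then w else - w)))"

lemma borel_measurable_unfold [measurable]: "unfold i \<in> borel_measurable borel"
  unfolding unfold_def split_beta by simp

lemma unfold_free_flight: "unfold i (free_flight s z) = free_flight s (unfold i z)"
  by (cases i; cases z) (auto simp: unfold_def free_flight_def)

text \<open>A velocity flip at a wall equals the isometry reflecting in that wall, which fixes the
  position; composing with it changes the group element from \<open>i\<close> to
  \<open>j\<close>.\<close>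

lemma unfold_reflect: "\<exists>j. unfold j (reflect (1/4) b z) = unfold i z"
proof -
  obtain x y u w where z: "z = ((x, y), (u, w))" by (metis surj_pair)
  obtain e m d n where i: "i = (e, m, d, n)" by (metis surj_pair)
  obtain u' w' where r: "reflect (1/4) b z = ((x, y), (u', w'))" by (simp add: z reflect_def)
  have "u' = u \<or> u' = - u \<and> (x = 0 \<or> x = 1/2 \<or> x = 1/4)"
    using r by (auto simp: z reflect_def mirror_def split: if_splits)
  then have "\<exists>e' m'. (if e' then x else - x) + real_of_int m' / 2 = (if e then x else - x) + m / 2 \<and>
      (if e' then u' else - u') = (if e then u else - u)"
  proof (elim disjE conjE)
    assume "u' = - u" "x = 0"
    then show ?thesis by (intro exI[of _ "\<not> e"] exI[of _ m]) auto
  next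
    assume eq: "u' = - u" "x = 1/2"
    show ?thesis
      unfolding eq by (rule exI[of _ "\<not> e"], rule exI[of _ "if e then m + 2 else m - 2"],
        cases e) (simp_all add: field_simps)
  next
    \<comment> \<open>Equality of positions forces \<open>m\<close> to change by
      \<open>4 * x\<close> up to sign: by 2 at the right side and by 1 here. That this is an integer
      is where \<open>a = 1/4\<close> enters.\<close>
    assume eq: "u' = - u" "x = 1/4"
    show ?thesis
      unfolding eq by (rule exI[of _ "\<not> e"], rule exI[of _ "if e then m + 1 else m - 1"],
        cases e) (simp_all add: field_simps)
  qed blast
  moreover have "w' = w \<or> w' = - w \<and> (y = 0 \<or> y = 1/2)"
    using r by (auto simp: z reflect_def split: if_splits)
  then have "\<exists>d' n'. (if d' then y else - y) + real_of_int n' = (if d then y else - y) + n \<and>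
      (if d' then w' else - w') = (if d then w else - w)"
  proof (elim disjE conjE)
    assume "w' = - w" "y = 0"
    then show ?thesis by (intro exI[of _ "\<not> d"] exI[of _ n]) auto
  next
    assume eq: "w' = - w" "y = 1/2"
    show ?thesis
      unfolding eq by (rule exI[of _ "\<not> d"], rule exI[of _ "if d then n + 1 else n - 1"],
        cases d) (simp_all add: field_simps)
  qed blast
  ultimately obtain e' m' d' n' where
    "(if e' then x else - x) + real_of_int m' / 2 = (if e then x else - x) + m / 2"
    "(if e' then u' else - u') = (if e then u else - u)"
    "(if d' then y else - y) + real_of_int n' = (if d then y else - y) + n"
    "(if d' then w' else - w') = (if d then w else - w)"
    by blast
  then have "unfold (e', m', d', n') (reflect (1/4) b z) = unfold i z"
    unfolding r unfolding z i unfold_def by (simp only: prod.case)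
  then show ?thesis ..
qed

lemma unfold_funpow_bounce:
  "\<exists>j. unfold j ((bounce (1/4) b ^^ n) z) = free_flight (bounce_time (1/4) b n z) (unfold i z)"
proof (induction n)
  case 0
  show ?case by (rule exI[of _ i]) (simp add: bounce_time_def)
next
  case (Suc n)
  let ?z = "(bounce (1/4) b ^^ n) z"
  let ?h = "hit_time (1/4) b ?z"
  obtain j where j: "unfold j ?z = free_flight (bounce_time (1/4) b n z) (unfold i z)"
    using Suc by blast
  obtain k where "unfold k (reflect (1/4) b (free_flight ?h ?z)) = unfold j (free_flight ?h ?z)"
    using unfold_reflect by blast
  then have "unfold k ((bounce (1/4) b ^^ Suc n) z) = free_flight (bounce_time (1/4) b (Suc n) z) (unfold i z)"
    by (simp add: bounce_def unfold_free_flight j bounce_time_def add.commute)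
  then show ?case by blast
qed

text \<open>The unfolding identity holds bounce by bounce, hence for whichever \<open>n\<close> the
  flow selects; \<open>j\<close> depends on \<open>z\<close> and \<open>t\<close>.\<close>

lemma unfold_flow: "\<exists>j. unfold j (flow (1/4) b t z) = free_flight t (unfold i z)"
proof -
  define n where "n = (LEAST n. t < bounce_time (1/4) b (Suc n) (reflect (1/4) b z))"
  obtain j where "unfold j (reflect (1/4) b z) = unfold i z" using unfold_reflect by blast
  moreover obtain k where "unfold k ((bounce (1/4) b ^^ n) (reflect (1/4) b z)) =
      free_flight (bounce_time (1/4) b n (reflect (1/4) b z)) (unfold j (reflect (1/4) b z))"
    using unfold_funpow_bounce by blast
  ultimately have "unfold k (flow (1/4) b t z) = free_flight t (unfold i z)"
    by (simp add: flow_def Let_def unfold_free_flight flip: n_def)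
  then show ?thesis by blast
qed

lemma unfold_id: "unfold (True, 0, True, 0) z = z"
  by (cases z) (auto simp: unfold_def)

text \<open>On \<open>phase_space\<close> the flow coincides pointwise with one of countably many invertible maps,
  which turns the image into a union of preimages.\<close>

lemma flow_image_eq:
  "flow (1/4) b t ` phase_space =
     (\<Union>i. {z. free_flight (- t) (unfold i z) \<in> phase_space \<and>
              flow (1/4) b t (free_flight (- t) (unfold i z)) = z})" (is "_ = ?R")
proof
  show "flow (1/4) b t ` phase_space \<subseteq> ?R"
  proof
    fix z assume "z \<in> flow (1/4) b t ` phase_space"
    then obtain z' where z': "z' \<in> phase_space" "z = flow (1/4) b t z'" by auto
    obtain j where "unfold j z = free_flight t z'"
      using unfold_flow[of b t z' "(True, 0, True, 0)"] by (auto simp: z'(2) unfold_id)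
    then have "free_flight (- t) (unfold j z) = z'" by simp
    then show "z \<in> ?R" using z' by (intro UN_I[of j]) auto
  qed
next
  show "?R \<subseteq> flow (1/4) b t ` phase_space"
  proof
    fix z assume "z \<in> ?R"
    then obtain i where "free_flight (- t) (unfold i z) \<in> phase_space"
      "flow (1/4) b t (free_flight (- t) (unfold i z)) = z" by blast
    then show "z \<in> flow (1/4) b t ` phase_space" by (metis imageI)
  qed
qed

lemma flow_image_borel: "flow (1/4) b t ` phase_space \<in> sets borel"
  unfolding flow_image_eq by measurable

lemma attractor_borel: "attractor (1/4) b \<in> sets borel"
  unfolding attractor_eq_INT_nat[of "1/4" b, simplified]
  using flow_image_borel by (intro sets.countable_INT) auto

section \<open>The attractor meets every interior fibre of the fold\<close>

text \<open>Copies of the table cover the plane: horizontally by translations by half units,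
  vertically by integer translations and the flip.\<close>

lemma unfold_onto: "\<exists>i. \<exists>z'\<in>phase_space. unfold i z' = ((\<xi>, \<eta>), (u, w))" if "u\<^sup>2 + w\<^sup>2 = 1"
proof -
  define x where "x = frac (2 * \<xi>) / 2"
  have x: "0 \<le> x" "x \<le> 1/2" "x + \<lfloor>2 * \<xi>\<rfloor> / 2 = \<xi>"
    using frac_lt_1[of "2 * \<xi>"] by (auto simp: x_def frac_def field_simps)
  have "\<exists>d n y. 0 \<le> y \<and> y \<le> 1/2 \<and> (if d then y else - y) + real_of_int n = \<eta>"
  proof (cases "frac \<eta> \<le> 1/2")
    case True
    then show ?thesis
      by (intro exI[of _ True] exI[of _ "\<lfloor>\<eta>\<rfloor>"] exI[of _ "frac \<eta>"]) (auto simp: frac_def)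
  next
    case False
    then show ?thesis using frac_lt_1[of \<eta>]
      by (intro exI[of _ False] exI[of _ "\<lfloor>\<eta>\<rfloor> + 1"] exI[of _ "1 - frac \<eta>"]) (auto simp: frac_def)
  qed
  then obtain d n y where y: "0 \<le> y" "y \<le> 1/2" "(if d then y else - y) + real_of_int n = \<eta>"
    by blast
  show ?thesis
  proof (intro exI bexI)
    show "unfold (True, \<lfloor>2 * \<xi>\<rfloor>, d, n) ((x, y), (u, if d then w else - w)) = ((\<xi>, \<eta>), (u, w))"
      using x y by (auto simp: unfold_def)
    show "((x, y), (u, if d then w else - w)) \<in> phase_space"
      using x y that by (auto simp: in_phase_space_iff)
  qed
qed

text \<open>For interior points the strict bounds force \<open>d\<close>, \<open>n = 0\<close>, and
  \<open>m = 0\<close> or \<open>m = 1\<close> according to \<open>e\<close>; the second choice is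
  the reflection in \<open>x = 1/4\<close>.\<close>

lemma unfold_fibre:
  assumes "0 < x" "x < 1/2" "0 < y" "y < 1/2"
    and z: "z \<in> phase_space" "unfold i z = ((x, y), (u, w))"
  shows "z = ((x, y), (u, w)) \<or> z = ((1/2 - x, y), (- u, w))"
proof -
  obtain x' y' u' w' where zz: "z = ((x', y'), (u', w'))" by (metis surj_pair)
  obtain e m d n where i: "i = (e, m, d, n)" by (metis surj_pair)
  have ps: "0 \<le> x'" "x' \<le> 1/2" "0 \<le> y'" "y' \<le> 1/2"
    using z by (auto simp: zz in_phase_space_iff)
  have eq: "(if e then x' else - x') + m / 2 = x" "(if e then u' else - u') = u"
    "(if d then y' else - y') + n = y" "(if d then w' else - w') = w"
    using z(2) by (auto simp: zz i unfold_def)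
  have "d" "n = 0"
  proof -
    show d
    proof (rule ccontr)
      assume "\<not> d"
      then have "0 < real_of_int n" "real_of_int n < 1" using eq ps assms by auto
      then show False by simp
    qed
    then have "-1 < real_of_int n" "real_of_int n < 1" using eq ps assms by auto
    then show "n = 0" by simp
  qed
  then have y: "y' = y" "w' = w" using eq by auto
  show ?thesis
  proof (cases e)
    case True
    then have "-1 < real_of_int m" "real_of_int m < 1" using eq ps assms by auto
    then have "m = 0" by simp
    then show ?thesis using True eq y by (simp add: zz)
  next
    case False
    then have "0 < real_of_int m" "real_of_int m < 2" using eq ps assms by auto
    then have "m = 1" by simp
    then show ?thesis using False eq y by (auto simp: zz)
  qed
qed

text \<open>Fly back along the straight line for time \<open>t\<close>, fold into the table, then
  apply the flow: the unfolded orbit returns to the given point, so the orbit ends in its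
  fibre.\<close>

lemma flow_image_covers:
  assumes xy: "0 < x" "x < 1/2" "0 < y" "y < 1/2" and uw: "u\<^sup>2 + w\<^sup>2 = 1" and t: "0 \<le> t"
  shows "((x, y), (u, w)) \<in> flow (1/4) b t ` phase_space \<or>
         ((1/2 - x, y), (- u, w)) \<in> flow (1/4) b t ` phase_space"
proof -
  obtain i z' where z': "z' \<in> phase_space" "unfold i z' = free_flight (- t) ((x, y), (u, w))"
    using unfold_onto[OF uw, of "x + - t * u" "y + - t * w"] by auto
  obtain j where "unfold j (flow (1/4) b t z') = free_flight t (unfold i z')"
    using unfold_flow by blast
  then have "unfold j (flow (1/4) b t z') = ((x, y), (u, w))" by (simp add: z'(2))
  moreover have "flow (1/4) b t z' \<in> phase_space"
    using flow_in_outgoing[of "1/4" z' t b] z' t by (auto simp: outgoing_def)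
  ultimately have "flow (1/4) b t z' = ((x, y), (u, w)) \<or> flow (1/4) b t z' = ((1/2 - x, y), (- u, w))"
    using unfold_fibre[OF xy] by blast
  then show ?thesis using z'(1) by (metis imageI)
qed

text \<open>If one point of the fibre were lost at time \<open>s\<close> and the other at
  \<open>t\<close>, both would be missing at \<open>max s t\<close>, because images
  decrease.\<close>

lemma attractor_covers:
  assumes xy: "0 < x" "x < 1/2" "0 < y" "y < 1/2" and uw: "u\<^sup>2 + w\<^sup>2 = 1"
  shows "((x, y), (u, w)) \<in> attractor (1/4) b \<or> ((1/2 - x, y), (- u, w)) \<in> attractor (1/4) b"
proof (rule ccontr)
  assume "\<not> ?thesis"
  then obtain s t where st: "0 \<le> s" "0 \<le> t" "((x, y), (u, w)) \<notin> flow (1/4) b s ` phase_space"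
    "((1/2 - x, y), (- u, w)) \<notin> flow (1/4) b t ` phase_space"
    by (auto simp: attractor_def)
  then show False
    using flow_image_covers[OF assms max.coboundedI1[OF st(1)], of b t]
      flow_image_antimono[of "1/4" s "max s t" b] flow_image_antimono[of "1/4" t "max s t" b]
    by auto
qed

section \<open>States without a past\<close>

text \<open>States just to the left of the mirror and moving away from it have no past: traced back,
  they would have come through the mirror from the right.\<close>

lemma not_in_attractor:
  assumes b: "b < 1/2" and x: "1/4 - b/8 < x" "x < 1/4" and y: "b/4 < y" "y < 3*b/4"
    and uw: "\<bar>w\<bar> < - u" "u\<^sup>2 + w\<^sup>2 = 1"
  shows "((x, y), (u, w)) \<notin> attractor (1/4) b"
proof
  let ?a = "1/4 :: real"
  assume "((x, y), (u, w)) \<in> attractor ?a b"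
  then have "((x, y), (u, w)) \<in> flow ?a b 1 ` phase_space"
    by (auto simp: attractor_def)
  then obtain z where z: "z \<in> phase_space" "flow ?a b 1 z = ((x, y), (u, w))" by auto
  have "0 < ?a" "?a < 1/2" by simp_all
  then obtain n r where nr: "r = 1 - bounce_time ?a b n (reflect ?a b z)" "0 \<le> r"
    "r < hit_time ?a b ((bounce ?a b ^^ n) (reflect ?a b z))"
    "(bounce ?a b ^^ n) (reflect ?a b z) \<in> outgoing ?a b"
    "flow ?a b 1 z = free_flight r ((bounce ?a b ^^ n) (reflect ?a b z))"
    using flow_cases[OF _ _ z(1) zero_le_one, of ?a b] by metis
  define z1 where "z1 = (bounce ?a b ^^ n) (reflect ?a b z)"
  have "free_flight (- r) (free_flight r z1) = free_flight (- r) ((x, y), (u, w))"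
    using nr(5) z(2) by (simp only: z1_def)
  then have z1: "z1 = ((x - r * u, y - r * w), (u, w))" by simp
  \<comment> \<open>Backward travel time to the line \<open>x = 1/4\<close>; it is compared with
    \<open>r\<close>, the time since the last bounce.\<close>
  define d where "d = (1/4 - x) / (- u)"
  have u: "u < 0" using uw by linarith
  have du: "d * u = x - 1/4" using u by (simp add: d_def)
  have dpos: "0 < d" using u x by (simp add: d_def divide_simps)
  \<comment> \<open>The direction is steeper towards the mirror than along it, so going back to the
    mirror line shifts the height by less than \<open>b/8\<close>, and it stays strictly between 0
    and \<open>b\<close>.\<close>
  have dw: "\<bar>s * w\<bar> < b/8" if "0 \<le> s" "s \<le> d" for s
  proof -
    have "\<bar>s * w\<bar> = s * \<bar>w\<bar>" using that by (simp add: abs_mult)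
    also have "\<dots> \<le> d * (- u)" using that uw by (intro mult_mono) auto
    finally show ?thesis using du x by simp
  qed
  show False
  proof (cases "d \<le> r")
    \<comment> \<open>The current free flight met the mirror from the right, where it should have
      been reflected. For \<open>r = d\<close> the start of the flight is itself not
      outgoing.\<close>
    case True
    have "reflect ?a b (free_flight (r - d) z1) = free_flight (r - d) z1"
      using nr True dpos by (intro reflect_free_flight_before_hit) (auto simp: z1_def)
    moreover have "free_flight (r - d) z1 = ((1/4, y - d * w), (u, w))"
      using du by (simp add: z1 algebra_simps)
    moreover have "0 \<le> y - d * w" "y - d * w \<le> b"
      using y dw[of d] dpos unfolding abs_less_iff by simp_all
    ultimately show False
      using u by (simp add: reflect_fixed_iff)
  next
    \<comment> \<open>The flight began strictly between the left side and the mirror line, at a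
      point on no wall.\<close>
    case False
    have x1: "0 < x - r * u" "x - r * u < 1/4"
    proof -
      have "0 \<le> r * (- u)" using nr(2) u by (intro mult_nonneg_nonneg) auto
      then show "0 < x - r * u" using x b y by simp
      have "r * (- u) < d * (- u)" using False u by (intro mult_strict_right_mono) auto
      then show "x - r * u < 1/4" using du by simp
    qed
    have y1: "0 < y - r * w" "y - r * w < 1/2" using dw[of r] False nr(2) y b unfolding abs_less_iff by simp_all
    \<comment> \<open>All velocities are covered because the velocity before the last bounce is
      unknown.\<close>
    have fixed: "reflect ?a b ((x - r * u, y - r * w), v) = ((x - r * u, y - r * w), v)" for v
      using x1 y1 by (cases v) (auto simp: reflect_fixed_iff)
    show False
    proof (cases n)
      \<comment> \<open>Without a bounce \<open>r = 1\<close>, but \<open>- u > 1/2\<close> and a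
        distance below \<open>b/8\<close> give \<open>d < 1\<close>.\<close>
      case 0
      have "w\<^sup>2 < u\<^sup>2" using uw(1) power_strict_mono[of "\<bar>w\<bar>" "- u" 2] by simp
      then have "(1/2)\<^sup>2 < u\<^sup>2" using uw by (simp add: power2_eq_square)
      then have "1/2 < - u" using u power2_less_imp_less[of "1/2" "- u"] by simp
      then have "d < 1" using x b y by (simp add: d_def divide_simps)
      then show False using 0 nr(1) False by (simp add: bounce_time_def)
    next
      case (Suc k)
      define z2 where "z2 = (bounce ?a b ^^ k) (reflect ?a b z)"
      have z2: "z2 \<in> outgoing ?a b"
        unfolding z2_def using z by (intro funpow_bounce_in_outgoing reflect_in_outgoing) auto
      define z3 where "z3 = free_flight (hit_time ?a b z2) z2"
      have "z1 = reflect ?a b z3" by (simp add: z1_def Suc bounce_def z2_def z3_def)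
      then have "fst z3 = (x - r * u, y - r * w)"
        by (cases z3) (auto simp: z1 reflect_def)
      then have "reflect ?a b z3 = z3" using fixed[of "snd z3"] by (metis prod.collapse)
      then show False
        using hit_time_in_collision_times[OF z2] by (simp add: collision_times_def z3_def)
    qed
  qed
qed

section \<open>The phase measure in angle coordinates\<close>

text \<open>Moves sets from the circle bundle to Euclidean space, where negligible sets and open
  sets are available. The half-open interval counts each direction once.\<close>

definition angle_coords :: "state set \<Rightarrow> ((real \<times> real) \<times> real) set" where
  "angle_coords A = {(p, \<theta>). p \<in> table \<and> \<theta> \<in> {0..<2 * pi} \<and> (p, (cos \<theta>, sin \<theta>)) \<in> A}"

lemma table_borel [measurable]: "table \<in> sets borel"
  unfolding table_def by (intro borel_closed closed_Times) auto

lemma angle_coords_borel: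
  assumes [measurable]: "A \<in> sets borel"
  shows "angle_coords A \<in> sets borel"
proof -
  have "{q :: (real \<times> real) \<times> real. fst q \<in> table \<and> snd q \<in> {0..<2 * pi} \<and>
      (fst q, (cos (snd q), sin (snd q))) \<in> A} \<in> sets borel"
    by measurable
  then show ?thesis by (simp add: angle_coords_def split_beta)
qed

text \<open>Fubini: each section over a point of the table has the arc length of its set of angles;
  off the table both integrands vanish.\<close>

lemma emeasure_phase_measure:
  assumes A: "A \<in> sets borel" "A \<subseteq> phase_space"
  shows "A \<in> sets phase_measure"
    and "emeasure phase_measure A = emeasure lborel (angle_coords A)"
proof -
  let ?T = "restrict_space lborel table" and ?N = "restrict_space lborel {0..<2 * pi}"
  let ?S = "restrict_space borel (sphere 0 1 :: (real \<times> real) set)"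
  let ?g = "\<lambda>\<theta>. (cos \<theta>, sin \<theta>) :: real \<times> real"
  have g: "?g \<in> ?N \<rightarrow>\<^sub>M ?S"
    by (intro measurable_restrict_space2 measurable_restrict_space1) (auto simp: norm_Pair)
  have sets_arc: "sets arc_length = sets ?S" by (simp add: arc_length_def)
  have "finite_measure ?N"
    by (intro finite_measureI) (simp add: emeasure_restrict_space space_restrict_space)
  then interpret arc: finite_measure arc_length
    unfolding arc_length_def by (intro finite_measure.finite_measure_distr g)
  \<comment> \<open>Makes Borel subsets of the phase space measurable for the product of the two
    restricted measures.\<close>
  have id: "(\<lambda>z. z) \<in> ?T \<Otimes>\<^sub>M arc_length \<rightarrow>\<^sub>M borel"
  proof -
    have "fst \<in> ?T \<Otimes>\<^sub>M arc_length \<rightarrow>\<^sub>M borel"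
      by (rule measurable_compose[OF measurable_fst]) (simp add: measurable_restrict_space1)
    moreover have "snd \<in> ?T \<Otimes>\<^sub>M arc_length \<rightarrow>\<^sub>M borel"
      by (rule measurable_compose[OF measurable_snd])
         (simp add: measurable_restrict_space1 measurable_cong_sets[OF sets_arc refl])
    ultimately have "(\<lambda>z. (fst z, snd z)) \<in> ?T \<Otimes>\<^sub>M arc_length \<rightarrow>\<^sub>M borel"
      by (rule borel_measurable_Pair)
    then show ?thesis by simp
  qed
  have space: "space (?T \<Otimes>\<^sub>M arc_length) = phase_space"
    using sets_eq_imp_space_eq[OF sets_arc]
    by (auto simp: space_pair_measure space_restrict_space phase_space_def)
  have A': "A \<in> sets (?T \<Otimes>\<^sub>M arc_length)"
    using measurable_sets[OF id A(1)] A(2) by (simp add: space Int_absorb2)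
  then show "A \<in> sets phase_measure" by (simp add: phase_measure_def)
  have arc: "emeasure arc_length (Pair p -` A) * indicator table p = emeasure lborel (Pair p -` angle_coords A)"
    for p
  proof (cases "p \<in> table")
    case True
    have "emeasure arc_length (Pair p -` A) = emeasure ?N (?g -` (Pair p -` A) \<inter> space ?N)"
      using sets_Pair1[OF A'] g sets_arc unfolding arc_length_def by (intro emeasure_distr) auto
    also have "\<dots> = emeasure lborel (?g -` (Pair p -` A) \<inter> space ?N)"
      by (intro emeasure_restrict_space) (auto simp: space_restrict_space)
    also have "?g -` (Pair p -` A) \<inter> space ?N = Pair p -` angle_coords A"
      using True by (auto simp: angle_coords_def space_restrict_space)
    finally show ?thesis using True by simp
  qed (simp add: angle_coords_def vimage_def)
  have "emeasure phase_measure A = emeasure (?T \<Otimes>\<^sub>M arc_length) A"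
    using A' by (simp add: phase_measure_def)
  also have "\<dots> = (\<integral>\<^sup>+ p. emeasure arc_length (Pair p -` A) \<partial>?T)"
    by (intro arc.emeasure_pair_measure_alt A')
  also have "\<dots> = (\<integral>\<^sup>+ p. emeasure arc_length (Pair p -` A) * indicator table p \<partial>lborel)"
    by (intro nn_integral_restrict_space) auto
  also have "\<dots> = (\<integral>\<^sup>+ p. emeasure lborel (Pair p -` angle_coords A) \<partial>lborel)"
    by (simp only: arc)
  also have "\<dots> = emeasure (lborel \<Otimes>\<^sub>M lborel) (angle_coords A)"
    using angle_coords_borel[OF A(1)]
    by (intro lborel.emeasure_pair_measure_alt[symmetric]) (simp only: lborel_prod sets_lborel)
  finally show "emeasure phase_measure A = emeasure lborel (angle_coords A)"
    by (simp add: lborel_prod)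
qed

section \<open>Positive but not full measure\<close>

lemma emeasure_attractor_pos: "0 < emeasure phase_measure (attractor (1/4) b)"
proof (rule ccontr)
  let ?A = "angle_coords (attractor (1/4) b)"
  \<comment> \<open>The reflection in \<open>x = 1/4\<close> in angle coordinates: it negates the
    cosine and keeps the sine. Being differentiable, it preserves negligible sets.\<close>
  let ?\<tau> = "\<lambda>q :: (real \<times> real) \<times> real. ((1/2 - fst (fst q), snd (fst q)), pi - snd q)"
  assume "\<not> ?thesis"
  then have "emeasure lborel ?A = 0"
    using emeasure_phase_measure[OF attractor_borel attractor_subset] by simp
  then have "?A \<in> null_sets lborel"
    using angle_coords_borel[OF attractor_borel] by (auto simp: null_sets_def)
  then have "negligible ?A"
    by (simp add: negligible_iff_null_sets null_sets_completionI)
  moreover have "negligible (?\<tau> ` ?A)"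
    using \<open>negligible ?A\<close>
    by (intro negligible_differentiable_image_negligible)
       (auto simp: differentiable_on_def differentiable_def intro!: derivative_eq_intros)
  ultimately have "negligible (?A \<union> ?\<tau> ` ?A)" by (rule negligible_Un)
  \<comment> \<open>Angles in \<open>(0, pi)\<close> are mapped to the same interval by
    \<open>pi - \<theta>\<close>, so nothing wraps around.\<close>
  moreover define B :: "((real \<times> real) \<times> real) set" where "B = ({0<..<1/2} \<times> {0<..<1/2}) \<times> {0<..<pi}"
  have "B \<subseteq> ?A \<union> ?\<tau> ` ?A"
  proof
    fix q assume "q \<in> B"
    then obtain x y \<theta> where q: "q = ((x, y), \<theta>)" "0 < x" "x < 1/2" "0 < y" "y < 1/2" "0 < \<theta>" "\<theta> < pi"
      by (auto simp: B_def)
    then have "q \<in> ?A \<or> ?\<tau> q \<in> ?A"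
      using attractor_covers[of x y "cos \<theta>" "sin \<theta>" b] by (auto simp: angle_coords_def table_def)
    moreover have "q = ?\<tau> (?\<tau> q)" by (simp add: q)
    ultimately show "q \<in> ?A \<union> ?\<tau> ` ?A" by blast
  qed
  ultimately have "negligible B" by (rule negligible_subset)
  moreover have "open B" unfolding B_def by (intro open_Times open_greaterThanLessThan)
  moreover have "((1/4, 1/4), pi/2) \<in> B" by (simp add: B_def)
  ultimately show False using open_not_negligible by blast
qed

text \<open>The states excluded by \<open>not_in_attractor\<close> fill a nonempty open set
  \<open>W\<close>, which has positive measure.\<close>

lemma emeasure_attractor_less:
  assumes b: "0 < b" "b < 1/2"
  shows "emeasure phase_measure (attractor (1/4) b) < emeasure phase_measure phase_space"
proof -
  define W :: "((real \<times> real) \<times> real) set" where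
    "W = {q. 1/4 - b/8 < fst (fst q) \<and> fst (fst q) < 1/4 \<and> b/4 < snd (fst q) \<and> snd (fst q) < 3*b/4 \<and>
             0 < snd q \<and> snd q < 2 * pi \<and> \<bar>sin (snd q)\<bar> < - cos (snd q)}"
  have "open W"
    unfolding W_def by (intro open_Collect_conj open_Collect_less continuous_intros)
  moreover have "((1/4 - b/16, b/2), pi) \<in> W" using b by (simp add: W_def)
  ultimately have "\<not> negligible W" using open_not_negligible by blast
  then have W0: "emeasure lborel W \<noteq> 0"
    using \<open>open W\<close> by (auto simp: negligible_iff_null_sets null_sets_def)
  have PS: "phase_space \<in> sets borel" by (rule phase_space_borel)
  have sub: "W \<subseteq> angle_coords phase_space" "angle_coords (attractor (1/4) b) \<subseteq> angle_coords phase_space - W"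
    using b attractor_subset[of "1/4" b] not_in_attractor[of b]
    by (auto simp: W_def angle_coords_def table_def in_phase_space_iff)
  have [measurable]: "W \<in> sets borel" "angle_coords phase_space \<in> sets borel"
    using \<open>open W\<close> angle_coords_borel[OF PS] by auto
  have "bounded ((({0..1/2} \<times> {0..1/2}) \<times> {0..2 * pi}) :: ((real \<times> real) \<times> real) set)"
    by (intro bounded_Times bounded_closed_interval)
  then have "bounded (angle_coords phase_space)"
    by (rule bounded_subset) (auto simp: angle_coords_def table_def)
  \<comment> \<open>Finite total measure makes removal of \<open>W\<close> a strict
    decrease.\<close>
  then have fin: "emeasure lborel (angle_coords phase_space) \<noteq> \<infinity>"
    using emeasure_bounded_finite by (auto simp: less_top)
  have "emeasure lborel (angle_coords (attractor (1/4) b)) \<le> emeasure lborel (angle_coords phase_space - W)"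
    using sub by (intro emeasure_mono) auto
  also have "\<dots> < emeasure lborel (angle_coords phase_space)"
  proof -
    have "emeasure lborel (angle_coords phase_space) =
        emeasure lborel (angle_coords phase_space - W) + emeasure lborel W"
      using sub by (subst plus_emeasure) (auto simp: Un_absorb2)
    then show ?thesis
      using fin W0 ennreal_add_left_cancel_less[of "emeasure lborel (angle_coords phase_space - W)" 0]
      by (simp add: zero_less_iff_neq_zero)
  qed
  finally show ?thesis
    using emeasure_phase_measure(2)[OF attractor_borel attractor_subset] emeasure_phase_measure(2)[OF PS]
    by simp
qed

theorem corollary6:
  fixes b :: real
  assumes "0 < b" and "b < 1/2"
  shows "attractor (1/4) b \<in> sets phase_measure
    \<and> 0 < emeasure phase_measure (attractor (1/4) b)
    \<and> emeasure phase_measure (attractor (1/4) b) < emeasure phase_measure phase_space"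
  using emeasure_phase_measure(1)[OF attractor_borel attractor_subset] emeasure_attractor_pos
    emeasure_attractor_less[OF assms]
  by simp

end
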